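(* For $z,w\in\mathbb{C}$ and $|\arg x|<\frac{\pi}{4}$, we have $$K_{z,w}(2x)=x^{-z}\int_{0}^{\infty}e^{-t^2-\frac{x^2}{t^2}}\cos(wt)\cos\left(\frac{wx}{t}\right)t^{2z-1}\,dt.$$
   Context: The generalized modified Bessel function is defined, for $z,w\in\mathbb{C}$, by $$K_{z,w}(x):=\frac{1}{2\pi i}\int_{c-i\infty}^{c+i\infty}\Gamma\left(\tfrac{s-z}{2}\right)\Gamma\left(\tfrac{s+z}{2}\right)\,{}_1F_1\left(\tfrac{s-z}{2};\tfrac12;-\tfrac{w^2}{4}\right){}_1F_1\left(\tfrac{s+z}{2};\tfrac12;-\tfrac{w^2}{4}\right)2^{s-2}x^{-s}\,ds,$$ where $c=\mathrm{Re}(s)>|\mathrm{Re}(z)|$ and powers of $x$ are principal. Here ${}_1F_1(a;c;u)=\sum_{n\ge0}\frac{(a)_n u^n}{(c)_n n!}$ with $(a)_n=a(a+1)\cdots(a+n-1)$. *)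

theory Defs
  imports "HOL-Analysis.Analysis"
begin

definition hyp1F1 :: "complex \<Rightarrow> complex \<Rightarrow> complex \<Rightarrow> complex" where
  "hyp1F1 a c u = (\<Sum>n. pochhammer a n * u ^ n / (pochhammer c n * fact n))"

definition gen_bessel_K_integrand :: "complex \<Rightarrow> complex \<Rightarrow> complex \<Rightarrow> complex \<Rightarrow> complex" where
  "gen_bessel_K_integrand z w x s =
     Gamma ((s - z) / 2) * Gamma ((s + z) / 2) *
     hyp1F1 ((s - z) / 2) (1 / 2) (- (w\<^sup>2 / 4)) * hyp1F1 ((s + z) / 2) (1 / 2) (- (w\<^sup>2 / 4)) *
     2 powr (s - 2) * x powr (- s)"

text \<open>
  The contour is the vertical line \<open>s = c + \<i> y\<close> with \<open>y\<close> real, so \<open>ds = \<i> dy\<close>. The abscissa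
  \<open>c\<close> is an explicit argument, meant to be used for \<open>c > \<bar>Re z\<bar>\<close>.
\<close>

definition gen_bessel_K :: "real \<Rightarrow> complex \<Rightarrow> complex \<Rightarrow> complex \<Rightarrow> complex" where
  "gen_bessel_K c z w x =
     1 / (2 * of_real pi * \<i>) *
     (LBINT y. gen_bessel_K_integrand z w x (Complex c y) * \<i>)"

end

theory Submission
  imports Defs "HOL-Probability.Characteristic_Functions"
begin

text \<open>
  On the logarithmic line \<open>t = exp u\<close>, let \<open>E \<zeta> = exp (- exp (2 * \<zeta>)) * cos (w * exp \<zeta>)\<close>, which is
  \<open>exp (- t\<^sup>2) * cos (w * t)\<close>, and let \<open>F s\<close> be its Mellin transform, the integral of
  \<open>E u * exp (s * u)\<close> over real \<open>u\<close>. Expanding the cosine shows that \<open>F s\<close> is half of the product of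
  \<open>Gamma (s / 2)\<close> and the confluent hypergeometric function at \<open>s / 2\<close>
  (\<open>gauss_cos_mellin_integral\<close>). So the integrand of the generalized Bessel function at \<open>2 * x\<close> is
  \<open>F (s - z) * F (s + z) * x powr (- s)\<close>: the powers of 2 cancel. Mellin inversion turns a product of
  transforms into a multiplicative convolution, and the convolution of \<open>E\<close> with itself, twisted by
  \<open>z\<close>, is exactly the integral on the right hand side, with \<open>t\<close> and \<open>x / t\<close> as the two points.

  Complex \<open>x\<close> and the convergence of the contour integral are handled together. The transform
  can be computed along any ray of angle less than \<open>pi / 4\<close> (\<open>Gamma_log_integral_rotated\<close>),
  therefore \<open>F (s + \<i> * y)\<close> is at most a constant times \<open>exp (- \<theta> * \<bar>y\<bar>)\<close> for each positive
  \<open>\<theta> < pi / 4\<close> (\<open>gauss_cos_mellin_decay\<close>). Since \<open>x powr (- s)\<close> grows at most like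
  \<open>exp (\<bar>Arg x\<bar> * \<bar>y\<bar>)\<close>, already one factor \<open>F\<close> makes the integral converge. The same freedom of the
  ray lets \<open>F (s - z)\<close> be inverted directly at complex points \<open>x / t\<close>
  (\<open>gauss_cos_mellin_inversion\<close>), by the Fourier inversion formula for bounded continuous functions
  with integrable transform (\<open>fourier_inversion\<close>, proved by Gaussian smoothing). Inserting the
  integral for the other factor and exchanging the order of integration proves the formula
  (\<open>mellin_convolution\<close>).
\<close>

section \<open>Integrals on the logarithmic line\<close>

text \<open>
  The substitution \<open>t = exp u\<close> turns Mellin transforms into Fourier transforms, and complex powers of
  \<open>t\<close> into exponentials that are defined for complex \<open>u\<close> as well.
\<close>

lemma exp_substitution:
  fixes f :: "real \<Rightarrow> complex"
  assumes cont: "continuous_on {0<..} f"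
  shows "has_bochner_integral lborel (\<lambda>u. exp u *\<^sub>R f (exp u)) b \<longleftrightarrow>
    set_integrable lborel {0<..} f \<and> (LBINT t:{0<..}. f t) = b"
proof -
  have im: "exp ` (UNIV :: real set) = {0<..}"
  proof (intro equalityI subsetI)
    fix t :: real assume "t \<in> {0<..}"
    then have "t = exp (ln t)" by simp
    then show "t \<in> range exp" by (rule range_eqI)
  qed auto
  \<comment> \<open>Borel measurability is what allows passing from the completed measure to \<open>lborel\<close>.\<close>
  have [measurable]: "(\<lambda>u. exp u *\<^sub>R f (exp u)) \<in> borel_measurable lborel"
    by (auto intro!: borel_measurable_continuous_onI continuous_intros
        continuous_on_compose2[OF cont])
  have [measurable]: "(\<lambda>t. indicator {0<..} t *\<^sub>R f t) \<in> borel_measurable lborel"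
    using borel_measurable_continuous_on_indicator[OF _ cont] by simp
  have "(\<lambda>u. \<bar>exp u\<bar> *\<^sub>R f (exp u)) absolutely_integrable_on UNIV \<and>
      integral UNIV (\<lambda>u. \<bar>exp u\<bar> *\<^sub>R f (exp u)) = b
    \<longleftrightarrow> f absolutely_integrable_on exp ` UNIV \<and> integral (exp ` UNIV) f = b"
    by (rule has_absolute_integral_change_of_variables_real)
       (auto intro!: derivative_eq_intros simp: inj_on_def)
  also have "(\<lambda>u. \<bar>exp u\<bar> *\<^sub>R f (exp u)) absolutely_integrable_on UNIV \<and>
      integral UNIV (\<lambda>u. \<bar>exp u\<bar> *\<^sub>R f (exp u)) = b \<longleftrightarrow>
      integrable lebesgue (\<lambda>u. exp u *\<^sub>R f (exp u)) \<and> (LINT u|lebesgue. exp u *\<^sub>R f (exp u)) = b"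
    using set_lebesgue_integral_eq_integral(2)[of UNIV "\<lambda>u. \<bar>exp u\<bar> *\<^sub>R f (exp u)"]
    by (auto simp: set_integrable_def set_lebesgue_integral_def)
  also have "\<dots> \<longleftrightarrow> has_bochner_integral lborel (\<lambda>u. exp u *\<^sub>R f (exp u)) b"
    by (subst integrable_completion, simp, subst integral_completion, simp)
       (simp add: has_bochner_integral_iff)
  also have "f absolutely_integrable_on exp ` UNIV \<and> integral (exp ` UNIV) f = b \<longleftrightarrow>
      integrable lebesgue (\<lambda>t. indicator {0<..} t *\<^sub>R f t) \<and>
      (LINT t|lebesgue. indicator {0<..} t *\<^sub>R f t) = b"
    unfolding im using set_lebesgue_integral_eq_integral(2)[of "{0<..}" f]
    by (auto simp: set_integrable_def set_lebesgue_integral_def)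
  also have "\<dots> \<longleftrightarrow> set_integrable lborel {0<..} f \<and> (LBINT t:{0<..}. f t) = b"
    by (subst integrable_completion, simp, subst integral_completion, simp)
       (simp add: set_integrable_def set_lebesgue_integral_def)
  finally show ?thesis .
qed

lemma has_bochner_integral_translate:
  fixes f :: "real \<Rightarrow> 'a::{banach, second_countable_topology}"
  assumes "has_bochner_integral lborel f I"
  shows "has_bochner_integral lborel (\<lambda>u. f (u + d)) I"
  using lborel_has_bochner_integral_real_affine_iff[of 1 f I d] assms
  by (simp add: add.commute)

lemma Gamma_log_integral:
  fixes a :: complex
  assumes "Re a > 0"
  shows "has_bochner_integral lborel (\<lambda>u. exp (- exp (of_real u) + a * of_real u)) (Gamma a)"
proof -
  let ?f = "\<lambda>t. complex_of_real t powr (a - 1) / of_real (exp t)"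
  have ai: "?f absolutely_integrable_on {0<..}"
    by (rule absolutely_integrable_Gamma_integral') fact
  have cont: "continuous_on {0<..} ?f"
    by (intro continuous_intros) (auto simp: complex_nonpos_Reals_iff)
  have m: "(\<lambda>t. indicator {0<..} t *\<^sub>R ?f t) \<in> borel_measurable lborel"
    using borel_measurable_continuous_on_indicator[OF _ cont] by simp
  have "set_integrable lborel {0<..} ?f"
    using ai unfolding set_integrable_def by (subst (asm) integrable_completion) (use m in simp_all)
  moreover have "(LBINT t:{0<..}. ?f t) = Gamma a"
    using Gamma_integral_complex'[OF assms] set_borel_integral_eq_integral(2)[OF calculation]
    by (simp add: integral_unique)
  ultimately have "has_bochner_integral lborel (\<lambda>u. exp u *\<^sub>R ?f (exp u)) (Gamma a)"
    using exp_substitution[OF cont] by blast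
  also have "(\<lambda>u. exp u *\<^sub>R ?f (exp u)) = (\<lambda>u. exp (- exp (of_real u) + a * of_real u))"
  proof
    fix u :: real
    have "complex_of_real (exp u) powr (a - 1) = exp (a * of_real u - of_real u)"
      by (simp add: powr_def Ln_of_real left_diff_distrib)
    then show "exp u *\<^sub>R ?f (exp u) = exp (- exp (of_real u) + a * of_real u)"
      by (simp add: scaleR_conv_of_real exp_diff exp_minus exp_add field_simps flip: exp_of_real)
  qed
  finally show ?thesis .
qed

lemma integrable_exp_minus_exp:
  fixes \<rho> \<sigma> :: real
  assumes "\<rho> > 0" "\<sigma> > 0"
  shows "integrable lborel (\<lambda>u. exp (- \<rho> * exp u + \<sigma> * u))"
proof -
  have "integrable lborel (\<lambda>u. norm (exp (- exp (complex_of_real u) + of_real \<sigma> * of_real u)))"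
    by (rule integrable_norm, rule integrable.intros[OF Gamma_log_integral])
       (use assms in simp)
  then have "integrable lborel (\<lambda>u. exp (- exp u + \<sigma> * u))"
    by (simp add: Re_exp)
  then have "integrable lborel (\<lambda>u. exp (- exp (u + ln \<rho>) + \<sigma> * (u + ln \<rho>)))"
    using has_bochner_integral_translate[of "\<lambda>u. exp (- exp u + \<sigma> * u)" _ "ln \<rho>"]
    by (auto simp: has_bochner_integral_iff)
  also have "(\<lambda>u. exp (- exp (u + ln \<rho>) + \<sigma> * (u + ln \<rho>))) =
      (\<lambda>u. exp (\<sigma> * ln \<rho>) * exp (- \<rho> * exp u + \<sigma> * u))"
  proof
    fix u :: real
    have "exp (u + ln \<rho>) = \<rho> * exp u"
      using assms by (simp add: exp_add)
    then show "exp (- exp (u + ln \<rho>) + \<sigma> * (u + ln \<rho>)) =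
        exp (\<sigma> * ln \<rho>) * exp (- \<rho> * exp u + \<sigma> * u)"
      by (simp add: algebra_simps flip: exp_add)
  qed
  finally show ?thesis by simp
qed

text \<open>
  The majorant for the integrals with the cosine, whose growth off the real axis is responsible for
  the term \<open>\<kappa> * exp u\<close>. Completing the square shows that this term is harmless.
\<close>

lemma integrable_exp_minus_exp_quadratic:
  fixes \<rho> \<kappa> \<sigma> :: real
  assumes "\<rho> > 0" "\<sigma> > 0"
  shows "integrable lborel (\<lambda>u. exp (- \<rho> * exp (2 * u) + \<kappa> * exp u + \<sigma> * u))"
proof (rule Bochner_Integration.integrable_bound)
  show "integrable lborel (\<lambda>u. exp ((\<kappa> + 1)\<^sup>2 / (4 * \<rho>)) * exp (- 1 * exp u + \<sigma> * u))"
    by (rule integrable_mult_right, rule integrable_exp_minus_exp) (use assms in auto)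
  have "- \<rho> * exp (2 * u) + \<kappa> * exp u \<le> (\<kappa> + 1)\<^sup>2 / (4 * \<rho>) - exp u" for u
  proof -
    have "0 \<le> (2 * \<rho> * exp u - (\<kappa> + 1))\<^sup>2 / (4 * \<rho>)"
      using assms by simp
    also have "\<dots> = \<rho> * (exp u)\<^sup>2 - (\<kappa> + 1) * exp u + (\<kappa> + 1)\<^sup>2 / (4 * \<rho>)"
      using assms by (simp add: field_simps power2_eq_square)
    finally show ?thesis
      by (simp add: algebra_simps power2_eq_square flip: exp_add)
  qed
  then show "AE u in lborel. norm (exp (- \<rho> * exp (2 * u) + \<kappa> * exp u + \<sigma> * u))
      \<le> norm (exp ((\<kappa> + 1)\<^sup>2 / (4 * \<rho>)) * exp (- 1 * exp u + \<sigma> * u))"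
    by (intro AE_I2) (simp add: algebra_simps flip: exp_add)
qed simp

text \<open>
  Dominated convergence for series. The partial sums of the norms share one integrable majorant,
  which is easier to exhibit here than a bound for the sum of the integrals of the norms.
\<close>

lemma has_bochner_integral_sums:
  fixes f :: "nat \<Rightarrow> real \<Rightarrow> complex"
  assumes int: "\<And>n. has_bochner_integral M (f n) (I n)"
    and S: "\<And>x. (\<lambda>n. f n x) sums S x"
    and D: "integrable M D" "\<And>n x. (\<Sum>i<n. norm (f i x)) \<le> D x"
  shows "integrable M S" "I sums integral\<^sup>L M S"
proof -
  have m[measurable]: "f n \<in> borel_measurable M" for n
    using int[of n] by (auto simp: has_bochner_integral_iff)
  have lim: "(\<lambda>n. \<Sum>i<n. f i x) \<longlonglongrightarrow> S x" for x
    using S by (simp add: sums_def)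
  have mS: "S \<in> borel_measurable M"
    by (rule borel_measurable_LIMSEQ_metric[OF _ lim]) (intro borel_measurable_sum m)
  have bd: "norm (\<Sum>i<n. f i x) \<le> D x" for n x
    by (rule order_trans[OF norm_sum D(2)])
  show "integrable M S"
    by (rule integrable_dominated_convergence[where s = "\<lambda>n x. \<Sum>i<n. f i x" and w = D])
       (use mS D(1) lim bd in auto)
  have "(\<lambda>n. \<integral>x. (\<Sum>i<n. f i x) \<partial>M) \<longlonglongrightarrow> integral\<^sup>L M S"
    by (rule integral_dominated_convergence[where w = D])
       (use mS D(1) lim bd in auto)
  also have "(\<lambda>n. \<integral>x. (\<Sum>i<n. f i x) \<partial>M) = (\<lambda>n. \<Sum>i<n. I i)"
    using int by (auto simp: has_bochner_integral_iff)
  finally show "I sums integral\<^sup>L M S"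
    by (simp add: sums_def)
qed

section \<open>The Gamma integral along rotated rays\<close>

lemma exp_partial_sum_le:
  fixes x :: real
  assumes "x \<ge> 0"
  shows "(\<Sum>i<n. x ^ i / fact i) \<le> exp x"
proof -
  have "(\<Sum>i<n. x ^ i /\<^sub>R fact i) \<le> (\<Sum>i. x ^ i /\<^sub>R fact i)"
    by (rule sum_le_suminf[OF summable_exp_generic]) (use assms in auto)
  then show ?thesis
    by (simp add: exp_def divide_inverse mult.commute)
qed

text \<open>
  The Gamma integral does not change when the ray of integration is turned by less than a right
  angle. No contour argument is needed: translating \<open>u\<close> changes the modulus of \<open>p = exp c\<close> at
  will, and of all numbers on a ray in the right half plane the one with modulus the cosine of the
  angle is the closest to 1, at distance less than 1. For this \<open>p\<close> the expansion of
  \<open>exp ((1 - p) * exp u)\<close> can be integrated termwise, and the resulting series is the binomial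
  series of \<open>p powr (- a)\<close>.
\<close>

lemma Gamma_log_integral_rotated:
  fixes a c :: complex
  assumes a: "Re a > 0" and c: "\<bar>Im c\<bar> < pi / 2"
  shows "has_bochner_integral lborel
    (\<lambda>u. exp (- exp (of_real u + c) + a * (of_real u + c))) (Gamma a)"
proof -
  \<comment> \<open>Among the numbers with imaginary part \<open>Im c\<close>, the one whose exponential \<open>p\<close> is closest to 1.\<close>
  define q where "q = Complex (ln (cos (Im c))) (Im c)"
  define p where "p = exp q"
  have cos: "cos (Im c) > 0"
    using c by (intro cos_gt_zero_pi) auto
  have p: "p = Complex ((cos (Im c))\<^sup>2) (cos (Im c) * sin (Im c))"
    using cos by (simp add: p_def q_def complex_eq_iff Re_exp Im_exp power2_eq_square)
  have "(cmod (1 - p))\<^sup>2 = (1 - (cos (Im c))\<^sup>2)\<^sup>2 + (cos (Im c))\<^sup>2 * (sin (Im c))\<^sup>2"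
    by (simp add: p cmod_power2 power_mult_distrib)
  also have "\<dots> = 1 - (cos (Im c))\<^sup>2"
    unfolding sin_squared_eq by (simp add: power2_eq_square algebra_simps)
  finally have "(cmod (1 - p))\<^sup>2 < 1"
    using cos by simp
  then have p1: "cmod (1 - p) < 1"
    by (simp add: power_less_one_iff abs_square_less_1)
  have Lnp: "Ln p = q"
    unfolding p_def using c pi_gt_zero by (intro Ln_exp) (auto simp: q_def)
  define f where "f = (\<lambda>n u. exp (a * q) * ((1 - p) ^ n / fact n) *
      exp (- exp (complex_of_real u) + (a + of_nat n) * of_real u))"
  define S where "S = (\<lambda>u. exp (- exp (complex_of_real u + q) + a * (of_real u + q)))"
  define D where "D = (\<lambda>u. cmod (exp (a * q)) * exp (- (1 - cmod (1 - p)) * exp u + Re a * u))"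
  have f_eq: "f n u = exp (a * q) * exp (- exp (of_real u) + a * of_real u) *
      (((1 - p) * exp (of_real u)) ^ n / fact n)" for n u
  proof -
    have "exp (- exp (of_real u) + (a + of_nat n) * of_real u) =
        exp (- exp (of_real u) + a * of_real u) * exp (complex_of_real u) ^ n"
      by (simp add: algebra_simps flip: exp_of_nat_mult exp_add)
    then show ?thesis
      by (simp add: f_def power_mult_distrib)
  qed
  have int: "has_bochner_integral lborel (f n)
      (exp (a * q) * ((1 - p) ^ n / fact n) * Gamma (a + of_nat n))" for n
    unfolding f_def
    by (intro has_bochner_integral_mult_right Gamma_log_integral) (use a in auto)
  have fS: "(\<lambda>n. f n u) sums S u" for u
  proof -
    have "(\<lambda>n. f n u) sums (exp (a * q) * exp (- exp (of_real u) + a * of_real u) *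
        exp ((1 - p) * exp (of_real u)))"
      unfolding f_eq using exp_converges[of "(1 - p) * exp (of_real u)"]
      by (intro sums_mult) (simp add: scaleR_conv_of_real divide_inverse mult.commute)
    also have "exp (a * q) * exp (- exp (of_real u) + a * of_real u) *
        exp ((1 - p) * exp (of_real u)) = S u"
      by (simp add: S_def p_def exp_add[of _ q] algebra_simps flip: exp_add)
    finally show ?thesis .
  qed
  have Dint: "integrable lborel D"
    unfolding D_def by (intro integrable_mult_right integrable_exp_minus_exp) (use p1 a in auto)
  have fD: "(\<Sum>i<n. cmod (f i u)) \<le> D u" for n u
  proof -
    have "(\<Sum>i<n. cmod (f i u)) = cmod (exp (a * q)) * exp (- exp u + Re a * u) *
        (\<Sum>i<n. (cmod (1 - p) * exp u) ^ i / fact i)"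
      unfolding f_eq sum_distrib_left
      by (simp add: norm_mult norm_divide norm_power Re_exp)
    also have "\<dots> \<le> cmod (exp (a * q)) * exp (- exp u + Re a * u) * exp (cmod (1 - p) * exp u)"
      by (intro mult_left_mono exp_partial_sum_le) auto
    also have "\<dots> = D u"
      by (simp add: D_def algebra_simps flip: exp_add)
    finally show ?thesis .
  qed
  note sums = has_bochner_integral_sums[OF int fS Dint fD]
  have ratio: "Gamma (a + of_nat n) = pochhammer a n * Gamma a" for n
  proof -
    have "a \<notin> \<int>\<^sub>\<le>\<^sub>0"
      using a by (auto elim!: nonpos_Ints_cases)
    then show ?thesis
      by (simp add: pochhammer_Gamma Gamma_eq_zero_iff)
  qed
  have "(\<lambda>n. ((- a) gchoose n) * (p - 1) ^ n) sums (1 + (p - 1)) powr (- a)"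
    by (rule gen_binomial_complex) (use p1 in \<open>simp add: norm_minus_commute\<close>)
  then have "(\<lambda>n. exp (a * q) * Gamma a * (((- a) gchoose n) * (p - 1) ^ n)) sums
      (exp (a * q) * Gamma a * exp (- a * q))"
    by (intro sums_mult) (use Lnp in \<open>simp add: powr_def p_def\<close>)
  also have "exp (a * q) * Gamma a * exp (- a * q) = Gamma a"
    by (simp add: exp_minus)
  also have "(\<lambda>n. exp (a * q) * Gamma a * (((- a) gchoose n) * (p - 1) ^ n)) =
      (\<lambda>n. exp (a * q) * ((1 - p) ^ n / fact n) * Gamma (a + of_nat n))"
  proof
    fix n
    have "(1 - p) ^ n = (- 1) ^ n * (p - 1) ^ n"
      by (simp flip: power_mult_distrib)
    then show "exp (a * q) * Gamma a * (((- a) gchoose n) * (p - 1) ^ n) =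
        exp (a * q) * ((1 - p) ^ n / fact n) * Gamma (a + of_nat n)"
      by (simp add: gbinomial_pochhammer ratio)
  qed
  finally have "integral\<^sup>L lborel S = Gamma a"
    using sums(2) sums_unique2 by blast
  with sums(1) have "has_bochner_integral lborel S (Gamma a)"
    by (simp add: has_bochner_integral_iff)
  then have "has_bochner_integral lborel (\<lambda>u. S (u + (Re c - ln (cos (Im c))))) (Gamma a)"
    by (rule has_bochner_integral_translate)
  moreover have "of_real (u + (Re c - ln (cos (Im c)))) + q = of_real u + c" for u
    by (simp add: q_def complex_eq_iff)
  ultimately show ?thesis
    by (simp only: S_def)
qed

lemma gaussian_log_integral:
  fixes s c :: complex
  assumes s: "Re s > 0" and c: "\<bar>Im c\<bar> < pi / 4"
  shows "has_bochner_integral lborel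
    (\<lambda>u. exp (- exp (2 * (of_real u + c)) + s * (of_real u + c))) (Gamma (s / 2) / 2)"
proof -
  have "has_bochner_integral lborel
      (\<lambda>u. exp (- exp (of_real u + 2 * c) + s / 2 * (of_real u + 2 * c))) (Gamma (s / 2))"
    by (rule Gamma_log_integral_rotated) (use assms in auto)
  then have "has_bochner_integral lborel
      (\<lambda>u. exp (- exp (of_real (0 + 2 * u) + 2 * c) + s / 2 * (of_real (0 + 2 * u) + 2 * c)))
      (Gamma (s / 2) /\<^sub>R \<bar>2\<bar>)"
    by (subst (asm) lborel_has_bochner_integral_real_affine_iff[of 2 _ _ 0]) auto
  then show ?thesis
    by (simp add: algebra_simps scaleR_conv_of_real)
qed

section \<open>The Gaussian cosine and its Mellin transform\<close>

text \<open>
  This is \<open>exp (- t\<^sup>2) * cos (w * t)\<close> at \<open>t = exp \<zeta>\<close>. With complex \<open>\<zeta>\<close> the imaginary part is the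
  angle by which the ray of integration is turned, and no branch of a power has to be chosen.
\<close>

definition gauss_cos :: "complex \<Rightarrow> complex \<Rightarrow> complex" where
  "gauss_cos w \<zeta> = exp (- exp (2 * \<zeta>)) * cos (w * exp \<zeta>)"

text \<open>
  The Mellin transform of \<open>exp (- t\<^sup>2) * cos (w * t)\<close> in closed form: up to powers of 2, one of the
  two factors that make up the integrand of the generalized Bessel function.
\<close>

definition gauss_cos_mellin :: "complex \<Rightarrow> complex \<Rightarrow> complex" where
  "gauss_cos_mellin w s = Gamma (s / 2) * hyp1F1 (s / 2) (1 / 2) (- (w\<^sup>2 / 4)) / 2"

lemma continuous_on_gauss_cos [continuous_intros]:
  fixes f :: "real \<Rightarrow> complex"
  shows "continuous_on A f \<Longrightarrow> continuous_on A (\<lambda>u. gauss_cos w (f u))"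
  unfolding gauss_cos_def by (intro continuous_intros)

lemma cmod_exp_minus_exp:
  "cmod (exp (- exp (2 * (of_real u + c)) + s * (of_real u + c))) =
    exp (- (exp (2 * Re c) * cos (2 * Im c)) * exp (2 * u) + Re s * u) * exp (Re (s * c))"
  by (simp add: Re_exp algebra_simps flip: exp_add)

lemma cmod_gauss_cos_le:
  "cmod (gauss_cos w (of_real u + c)) \<le>
    exp (- (exp (2 * Re c) * cos (2 * Im c)) * exp (2 * u) + cmod w * exp (Re c) * exp u)"
proof -
  have "cmod (gauss_cos w (of_real u + c)) \<le>
      cmod (exp (- exp (2 * (of_real u + c)))) * exp (cmod (w * exp (of_real u + c)))"
    unfolding gauss_cos_def norm_mult[of _ "cos _"]
    by (intro mult_left_mono norm_cos_le) auto
  also have "\<dots> = exp (- (exp (2 * Re c) * cos (2 * Im c)) * exp (2 * u) +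
      cmod w * exp (Re c) * exp u)"
  proof -
    have "cmod (w * exp (of_real u + c)) = cmod w * exp (Re c) * exp u"
      by (simp add: norm_mult exp_add)
    then show ?thesis
      using cmod_exp_minus_exp[of u c 0] by (simp only: exp_add) simp
  qed
  finally show ?thesis .
qed

text \<open>
  Expanding the cosine and integrating termwise gives Gamma functions at \<open>s / 2 + n\<close>, hence the
  rising factorials of \<open>s / 2\<close>; the factorials of \<open>2 * n\<close> split into \<open>4 ^ n\<close>, \<open>fact n\<close> and the rising
  factorials of \<open>1 / 2\<close>. The value is the same on every ray \<open>Im c\<close> in the sector where
  \<open>exp (- t\<^sup>2)\<close> decays, and this is what yields decay of the transform in the vertical direction.
\<close>

theorem gauss_cos_mellin_integral:
  fixes s c :: complex
  assumes s: "Re s > 0" and c: "\<bar>Im c\<bar> < pi / 4"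
  shows "has_bochner_integral lborel
    (\<lambda>u. gauss_cos w (of_real u + c) * exp (s * (of_real u + c))) (gauss_cos_mellin w s)"
proof -
  define \<rho> where "\<rho> = exp (2 * Re c) * cos (2 * Im c)"
  define \<kappa> where "\<kappa> = cmod w * exp (Re c)"
  define f where "f = (\<lambda>n u. of_real (cos_coeff n) * w ^ n *
      exp (- exp (2 * (complex_of_real u + c)) + (s + of_nat n) * (of_real u + c)))"
  define S where "S = (\<lambda>u. gauss_cos w (of_real u + c) * exp (s * (of_real u + c)))"
  define D where "D = (\<lambda>u. exp (- \<rho> * exp (2 * u) + \<kappa> * exp u + Re s * u) * exp (Re (s * c)))"
  define I where "I = (\<lambda>n. of_real (cos_coeff n) * w ^ n * (Gamma ((s + of_nat n) / 2) / 2))"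
  have \<rho>: "\<rho> > 0"
    unfolding \<rho>_def using c by (intro mult_pos_pos cos_gt_zero_pi) auto
  have f_eq: "f n u = exp (- exp (2 * (of_real u + c)) + s * (of_real u + c)) *
      (of_real (cos_coeff n) * (w * exp (of_real u + c)) ^ n)" for n u
    by (simp add: f_def power_mult_distrib algebra_simps flip: exp_of_nat_mult exp_add)
  have int: "has_bochner_integral lborel (f n) (I n)" for n
    unfolding f_def I_def
    by (intro has_bochner_integral_mult_right gaussian_log_integral) (use s c in auto)
  have fS: "(\<lambda>n. f n u) sums S u" for u
  proof -
    have "(\<lambda>n. f n u) sums (exp (- exp (2 * (of_real u + c)) + s * (of_real u + c)) *
        cos (w * exp (of_real u + c)))"
      unfolding f_eq using cos_converges[of "w * exp (of_real u + c)"]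
      by (intro sums_mult) (simp add: scaleR_conv_of_real)
    then show ?thesis
      by (simp add: S_def gauss_cos_def exp_diff exp_minus field_simps)
  qed
  have Dint: "integrable lborel D"
    unfolding D_def
    by (intro integrable_mult_left integrable_exp_minus_exp_quadratic) (use \<rho> s in auto)
  have fD: "(\<Sum>i<n. cmod (f i u)) \<le> D u" for n u
  proof -
    let ?A = "exp (- \<rho> * exp (2 * u) + Re s * u) * exp (Re (s * c))"
    have "(\<Sum>i<n. cmod (f i u)) = ?A * (\<Sum>i<n. \<bar>cos_coeff i\<bar> * (\<kappa> * exp u) ^ i)"
      unfolding f_eq sum_distrib_left norm_mult[of "exp _"] cmod_exp_minus_exp \<rho>_def
      by (simp add: norm_mult norm_power \<kappa>_def exp_add mult_ac)
    also have "\<dots> \<le> ?A * (\<Sum>i<n. (\<kappa> * exp u) ^ i / fact i)"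
    proof (intro mult_left_mono sum_mono)
      fix i
      have "\<bar>cos_coeff i\<bar> * (\<kappa> * exp u) ^ i \<le> (1 / fact i) * (\<kappa> * exp u) ^ i"
        by (intro mult_right_mono) (auto simp: \<kappa>_def cos_coeff_def abs_mult)
      then show "\<bar>cos_coeff i\<bar> * (\<kappa> * exp u) ^ i \<le> (\<kappa> * exp u) ^ i / fact i"
        by simp
    qed auto
    also have "\<dots> \<le> ?A * exp (\<kappa> * exp u)"
      by (intro mult_left_mono exp_partial_sum_le) (auto simp: \<kappa>_def)
    also have "\<dots> = D u"
      by (simp add: D_def algebra_simps flip: exp_add)
    finally show ?thesis .
  qed
  note sums = has_bochner_integral_sums[OF int fS Dint fD]
  have pole_free: "s / 2 \<notin> \<int>\<^sub>\<le>\<^sub>0"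
    using s by (auto elim!: nonpos_Ints_cases simp: complex_eq_iff)
  then have ratio: "Gamma ((s + of_nat (2 * n)) / 2) = pochhammer (s / 2) n * Gamma (s / 2)" for n
    by (simp add: pochhammer_Gamma Gamma_eq_zero_iff add_divide_distrib)
  have "I sums integral\<^sup>L lborel S"
    by (rule sums(2))
  then have "(\<lambda>n. I (2 * n)) sums integral\<^sup>L lborel S"
    by (subst sums_mono_reindex)
       (auto simp: strict_mono_def I_def cos_coeff_def elim!: evenE)
  also have "(\<lambda>n. I (2 * n)) = (\<lambda>n. Gamma (s / 2) / 2 * (pochhammer (s / 2) n *
      (- (w\<^sup>2 / 4)) ^ n / (pochhammer (1 / 2) n * fact n)))"
  proof
    fix n
    have "(- (w\<^sup>2 / 4)) ^ n = (- 1) ^ n * w ^ (2 * n) / 2 ^ (2 * n)"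
      by (simp add: power_minus[of "w\<^sup>2 / 4"] power_divide power_mult)
    moreover have "complex_of_real (cos_coeff (2 * n)) = (- 1) ^ n / fact (2 * n)"
      by (simp add: cos_coeff_def)
    then have "complex_of_real (cos_coeff (2 * n)) =
        (- 1) ^ n / (2 ^ (2 * n) * pochhammer (1 / 2) n * fact n)"
      by (simp only: fact_double)
    ultimately show "I (2 * n) = Gamma (s / 2) / 2 * (pochhammer (s / 2) n *
      (- (w\<^sup>2 / 4)) ^ n / (pochhammer (1 / 2) n * fact n))"
      unfolding I_def ratio by (simp add: mult_ac)
  qed
  finally have sum: "(\<lambda>n. Gamma (s / 2) / 2 * (pochhammer (s / 2) n *
      (- (w\<^sup>2 / 4)) ^ n / (pochhammer (1 / 2) n * fact n))) sums integral\<^sup>L lborel S" .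
  have "integral\<^sup>L lborel S = gauss_cos_mellin w s"
  proof -
    have "Gamma (s / 2) / 2 \<noteq> 0"
      using pole_free by (simp add: Gamma_eq_zero_iff)
    then have "summable (\<lambda>n. pochhammer (s / 2) n * (- (w\<^sup>2 / 4)) ^ n /
        (pochhammer (1 / 2) n * fact n))"
      using sums_summable[OF sum] by (subst (asm) summable_cmult_iff) auto
    then show ?thesis
      using sums_unique[OF sum] unfolding gauss_cos_mellin_def hyp1F1_def
      by (subst (asm) suminf_mult) simp_all
  qed
  with sums(1) show ?thesis
    by (simp add: has_bochner_integral_iff S_def)
qed

section \<open>Fourier inversion\<close>

lemma fourier_measurable:
  fixes B :: "real \<Rightarrow> complex"
  assumes [measurable]: "B \<in> borel_measurable borel"
  shows "(\<lambda>y. LBINT u. B u * iexp (y * u)) \<in> borel_measurable borel"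
  by (rule lborel.borel_measurable_lebesgue_integral) measurable

lemma integrable_times_iexp:
  fixes B :: "real \<Rightarrow> complex"
  assumes "integrable lborel B"
  shows "integrable lborel (\<lambda>u. B u * iexp (y * u))"
proof (rule Bochner_Integration.integrable_bound[OF assms])
  have [measurable]: "B \<in> borel_measurable borel"
    using assms by (auto dest: borel_measurable_integrable)
  show "(\<lambda>u. B u * iexp (y * u)) \<in> borel_measurable lborel"
    by measurable
qed (simp add: norm_mult)

text \<open>
  Fubini for the Fourier kernel. It serves twice: with a Gaussian in the proof of the inversion
  formula, and to turn a product of transforms into a convolution.
\<close>

lemma fourier_multiplication_formula:
  fixes A B :: "real \<Rightarrow> complex"
  assumes A: "integrable lborel A" and B: "integrable lborel B"
  shows "(LBINT y. A y * (LBINT u. B u * iexp (y * u))) =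
    (LBINT u. B u * (LBINT y. A y * iexp (y * u)))"
proof -
  have [measurable]: "A \<in> borel_measurable borel" "B \<in> borel_measurable borel"
    using A B by (auto dest: borel_measurable_integrable)
  have "integrable (lborel \<Otimes>\<^sub>M lborel) (\<lambda>(y, u). A y * (B u * iexp (y * u)))"
  proof (rule lborel_pair.Fubini_integrable)
    show "(\<lambda>(y, u). A y * (B u * iexp (y * u))) \<in> borel_measurable (lborel \<Otimes>\<^sub>M lborel)"
      by measurable
    show "integrable lborel
        (\<lambda>y. LBINT u. norm (case (y, u) of (y, u) \<Rightarrow> A y * (B u * iexp (y * u))))"
      using A by (simp add: norm_mult)
    show "AE y in lborel. integrable lborel
        (\<lambda>u. case (y, u) of (y, u) \<Rightarrow> A y * (B u * iexp (y * u)))"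
      using integrable_times_iexp[OF B] by simp
  qed
  then have "(LBINT u. LBINT y. A y * (B u * iexp (y * u))) =
      (LBINT y. LBINT u. A y * (B u * iexp (y * u)))"
    by (rule lborel_pair.Fubini_integral)
  moreover have "(LBINT u. A y * (B u * iexp (y * u))) = A y * (LBINT u. B u * iexp (y * u))" for y
    by (rule integral_mult_right_zero)
  moreover have "(LBINT y. A y * (B u * iexp (y * u))) = B u * (LBINT y. A y * iexp (y * u))" for u
    unfolding mult.left_commute[of _ "B u"] by (rule integral_mult_right_zero)
  ultimately show ?thesis
    by (simp only:)
qed

lemma std_normal_fourier:
  "has_bochner_integral lborel (\<lambda>v. of_real (std_normal_density v) * iexp (t * v))
    (of_real (exp (- (t\<^sup>2 / 2))))"
proof -
  have "integrable lborel std_normal_density"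
    using integrable_std_normal_moment[of 0] by simp
  then have "integrable lborel (\<lambda>v. of_real (std_normal_density v) * iexp (t * v))"
    by (intro integrable_times_iexp integrable_of_real)
  moreover have "(LBINT v. of_real (std_normal_density v) * iexp (t * v)) =
      of_real (exp (- (t\<^sup>2 / 2)))"
  proof -
    have "(LBINT v. of_real (std_normal_density v) * iexp (t * v)) = char std_normal_distribution t"
      unfolding char_def by (subst integral_density) (auto simp: scaleR_conv_of_real)
    then show ?thesis
      by (simp add: char_std_normal_distribution)
  qed
  ultimately show ?thesis
    by (simp add: has_bochner_integral_iff)
qed

lemma std_normal_fourier_scaled:
  assumes "\<delta> > 0"
  shows "has_bochner_integral lborel (\<lambda>y. of_real (std_normal_density (\<delta> * y)) * iexp (t * y))
    (of_real (exp (- ((t / \<delta>)\<^sup>2 / 2)) / \<delta>))"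
proof -
  let ?f = "\<lambda>v. of_real (std_normal_density v) * iexp (t / \<delta> * v)"
  have "has_bochner_integral lborel (\<lambda>y. ?f (0 + \<delta> * y))
      (of_real (exp (- ((t / \<delta>)\<^sup>2 / 2))) /\<^sub>R \<bar>\<delta>\<bar>)"
    by (rule iffD1[OF lborel_has_bochner_integral_real_affine_iff[of \<delta> ?f _ 0]
          std_normal_fourier[of "t / \<delta>"]]) (use assms in simp)
  moreover have "t / \<delta> * (\<delta> * y) = t * y" for y
    using assms by simp
  moreover have "of_real (exp (- ((t / \<delta>)\<^sup>2 / 2))) /\<^sub>R \<bar>\<delta>\<bar> =
      complex_of_real (exp (- ((t / \<delta>)\<^sup>2 / 2)) / \<delta>)"
    using assms by (simp add: scaleR_conv_of_real field_simps)
  ultimately show ?thesis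
    by (simp only: add_0)
qed

text \<open>
  Damping the inversion integral with a Gaussian makes it absolutely convergent whatever the
  transform does. Up to scaling a Gaussian is its own Fourier transform, so the damped integral is \<open>2 * pi\<close>
  times an average
  of \<open>H\<close> at scale \<open>\<delta>\<close> around \<open>\<rho>\<close>.
\<close>

lemma fourier_inversion_mollified:
  fixes H :: "real \<Rightarrow> complex"
  assumes H: "integrable lborel H" and \<delta>: "\<delta> > 0"
  shows "(LBINT y. (LBINT u. H u * iexp (y * u)) * iexp (- (\<rho> * y)) * of_real (exp (- ((\<delta> * y)\<^sup>2 / 2))))
    = 2 * pi * (LBINT v. H (\<rho> + \<delta> * v) * of_real (std_normal_density v))"
proof -
  define A where "A = (\<lambda>y. of_real (std_normal_density (\<delta> * y)) * iexp (- \<rho> * y))"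
  have A: "integrable lborel A"
    unfolding A_def by (rule integrable.intros[OF std_normal_fourier_scaled[OF \<delta>]])
  have gauss: "exp (- (x\<^sup>2 / 2)) = sqrt (2 * pi) * std_normal_density x" for x
    by (simp add: std_normal_density_def)
  have sqrt2pi: "complex_of_real (sqrt (2 * pi)) * of_real (sqrt (2 * pi)) = of_real (2 * pi)"
    by (subst of_real_mult[symmetric]) simp
  have Ahat: "(LBINT y. A y * iexp (y * u)) =
      of_real (sqrt (2 * pi) * std_normal_density ((u - \<rho>) / \<delta>) / \<delta>)" for u
  proof -
    have "A y * iexp (y * u) = of_real (std_normal_density (\<delta> * y)) * iexp ((u - \<rho>) * y)" for y
      by (simp add: A_def algebra_simps flip: exp_add)
    then show ?thesis
      using std_normal_fourier_scaled[OF \<delta>, of "u - \<rho>"]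
      unfolding gauss by (simp only: has_bochner_integral_iff)
  qed
  have "(LBINT y. (LBINT u. H u * iexp (y * u)) * iexp (- (\<rho> * y)) * of_real (exp (- ((\<delta> * y)\<^sup>2 / 2))))
      = (LBINT y. of_real (sqrt (2 * pi)) * (A y * (LBINT u. H u * iexp (y * u))))"
    unfolding gauss A_def by (intro Bochner_Integration.integral_cong) (auto simp: mult_ac)
  also have "\<dots> = of_real (sqrt (2 * pi)) * (LBINT u. H u * (LBINT y. A y * iexp (y * u)))"
    by (simp only: integral_mult_right_zero fourier_multiplication_formula[OF A H])
  also have "\<dots> = of_real (sqrt (2 * pi)) *
      (LBINT u. H u * of_real (sqrt (2 * pi) * std_normal_density ((u - \<rho>) / \<delta>) / \<delta>))"
    unfolding Ahat ..
  also have "\<dots> = of_real (sqrt (2 * pi)) * (\<bar>\<delta>\<bar> *\<^sub>R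
      (LBINT v. H (\<rho> + \<delta> * v) * of_real (sqrt (2 * pi) * std_normal_density (((\<rho> + \<delta> * v) - \<rho>) / \<delta>) / \<delta>)))"
    using \<delta> by (subst lborel_integral_real_affine[where c = \<delta> and t = \<rho>]) auto
  also have "\<dots> = of_real (sqrt (2 * pi)) * (LBINT v. \<delta> *\<^sub>R
      (H (\<rho> + \<delta> * v) * of_real (sqrt (2 * pi) * std_normal_density (((\<rho> + \<delta> * v) - \<rho>) / \<delta>) / \<delta>)))"
    by (simp only: integral_scaleR_right abs_of_pos[OF \<delta>])
  also have "\<dots> = of_real (sqrt (2 * pi)) * (LBINT v. of_real (sqrt (2 * pi)) *
      (H (\<rho> + \<delta> * v) * of_real (std_normal_density v)))"
    using \<delta> by (intro arg_cong2[of _ _ _ _ "(*)"] refl Bochner_Integration.integral_cong)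
      (simp add: scaleR_conv_of_real)
  also have "\<dots> = 2 * pi * (LBINT v. H (\<rho> + \<delta> * v) * of_real (std_normal_density v))"
    by (subst integral_mult_right_zero) (simp only: mult.assoc[symmetric] sqrt2pi)
  finally show ?thesis .
qed

text \<open>
  Both sides of the mollified identity converge by dominated convergence as \<open>\<delta>\<close> tends to 0: the
  left side because the transform is integrable, the right side because \<open>H\<close> is bounded and
  continuous.
\<close>

theorem fourier_inversion:
  fixes H :: "real \<Rightarrow> complex"
  assumes H: "integrable lborel H" and cont: "continuous_on UNIV H"
    and bdd: "\<And>u. cmod (H u) \<le> B"
    and Hhat: "integrable lborel (\<lambda>y. LBINT u. H u * iexp (y * u))"
  shows "(LBINT y. (LBINT u. H u * iexp (y * u)) * iexp (- (\<rho> * y))) = 2 * pi * H \<rho>"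
proof -
  let ?F = "\<lambda>y. LBINT u. H u * iexp (y * u)"
  define \<delta> where "\<delta> = (\<lambda>n. inverse (real (Suc n)))"
  have \<delta>: "\<delta> n > 0" for n
    by (simp add: \<delta>_def)
  have \<delta>0: "\<delta> \<longlonglongrightarrow> 0"
    unfolding \<delta>_def by (rule LIMSEQ_inverse_real_of_nat)
  have [measurable]: "H \<in> borel_measurable borel" "?F \<in> borel_measurable borel"
    using H Hhat by (auto dest: borel_measurable_integrable)
  have isc: "isCont H x" for x
    using cont by (simp add: continuous_on_eq_continuous_at)
  have "(\<lambda>n. LBINT y. ?F y * iexp (- (\<rho> * y)) * of_real (exp (- ((\<delta> n * y)\<^sup>2 / 2)))) \<longlonglongrightarrow>
      (LBINT y. ?F y * iexp (- (\<rho> * y)))"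
  proof (rule integral_dominated_convergence[where w = "\<lambda>y. norm (?F y)"])
    show "AE y in lborel. (\<lambda>n. ?F y * iexp (- (\<rho> * y)) * of_real (exp (- ((\<delta> n * y)\<^sup>2 / 2))))
        \<longlonglongrightarrow> ?F y * iexp (- (\<rho> * y))"
    proof (rule AE_I2)
      fix y
      have "(\<lambda>n. ?F y * iexp (- (\<rho> * y)) * of_real (exp (- ((\<delta> n * y)\<^sup>2 / 2)))) \<longlonglongrightarrow>
          ?F y * iexp (- (\<rho> * y)) * of_real (exp (- ((0 * y)\<^sup>2 / 2)))"
        by (intro tendsto_intros \<delta>0) auto
      then show "(\<lambda>n. ?F y * iexp (- (\<rho> * y)) * of_real (exp (- ((\<delta> n * y)\<^sup>2 / 2))))
          \<longlonglongrightarrow> ?F y * iexp (- (\<rho> * y))"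
        by simp
    qed
    show "AE y in lborel. norm (?F y * iexp (- (\<rho> * y)) * of_real (exp (- ((\<delta> n * y)\<^sup>2 / 2))))
        \<le> norm (?F y)" for n
      by (intro AE_I2) (simp add: norm_mult mult_left_le)
    show "integrable lborel (\<lambda>y. norm (?F y))"
      using Hhat by (rule integrable_norm)
  qed measurable
  then have lim1: "(\<lambda>n. 2 * pi * (LBINT v. H (\<rho> + \<delta> n * v) * of_real (std_normal_density v))) \<longlonglongrightarrow>
      (LBINT y. ?F y * iexp (- (\<rho> * y)))"
    by (simp only: fourier_inversion_mollified[OF H \<delta>])
  have lim2: "(\<lambda>n. 2 * pi * (LBINT v. H (\<rho> + \<delta> n * v) * of_real (std_normal_density v))) \<longlonglongrightarrow>
      2 * pi * (LBINT v. H \<rho> * of_real (std_normal_density v))"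
  proof (intro tendsto_mult tendsto_const
      integral_dominated_convergence[where w = "\<lambda>v. B * std_normal_density v"])
    show "AE v in lborel. (\<lambda>n. H (\<rho> + \<delta> n * v) * of_real (std_normal_density v)) \<longlonglongrightarrow>
        H \<rho> * of_real (std_normal_density v)"
    proof (rule AE_I2)
      fix v
      have "(\<lambda>n. \<rho> + \<delta> n * v) \<longlonglongrightarrow> \<rho> + 0 * v"
        by (intro tendsto_intros \<delta>0)
      then have "(\<lambda>n. H (\<rho> + \<delta> n * v)) \<longlonglongrightarrow> H \<rho>"
        using isCont_tendsto_compose[OF isc] by simp
      then show "(\<lambda>n. H (\<rho> + \<delta> n * v) * of_real (std_normal_density v)) \<longlonglongrightarrow>
          H \<rho> * of_real (std_normal_density v)"
        by (intro tendsto_intros)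
    qed
    show "AE v in lborel. norm (H (\<rho> + \<delta> n * v) * of_real (std_normal_density v)) \<le>
        B * std_normal_density v" for n
      by (intro AE_I2) (simp add: norm_mult mult_right_mono bdd)
    show "integrable lborel (\<lambda>v. B * std_normal_density v)"
      using integrable_std_normal_moment[of 0] by simp
  qed measurable
  have "(LBINT v. H \<rho> * of_real (std_normal_density v)) = H \<rho>"
    using std_normal_fourier[of 0] by (simp add: has_bochner_integral_iff)
  with LIMSEQ_unique[OF lim1 lim2] show ?thesis
    by (simp only:)
qed

section \<open>Mellin inversion and convolution for the Gaussian cosine\<close>

text \<open>
  Fourier inversion asks for this bound, and it also makes the convolution integral converge.
\<close>

lemma gauss_cos_exp_bounded:
  assumes s: "Re s > 0" and c: "\<bar>Im c\<bar> < pi / 4"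
  obtains B where "\<And>u. cmod (gauss_cos w (of_real u + c) * exp (s * (of_real u + c))) \<le> B"
proof
  fix u
  define \<rho> where "\<rho> = exp (2 * Re c) * cos (2 * Im c)"
  define \<kappa> where "\<kappa> = cmod w * exp (Re c)"
  have \<rho>: "\<rho> > 0"
    unfolding \<rho>_def using c by (intro mult_pos_pos cos_gt_zero_pi) auto
  \<comment> \<open>Replacing \<open>u\<close> by the larger \<open>exp u\<close> leaves a quadratic in \<open>exp u\<close>, bounded by its vertex.\<close>
  have "0 \<le> (2 * \<rho> * exp u - (\<kappa> + Re s))\<^sup>2 / (4 * \<rho>)"
    using \<rho> by simp
  also have "\<dots> = \<rho> * exp (2 * u) - (\<kappa> + Re s) * exp u + (\<kappa> + Re s)\<^sup>2 / (4 * \<rho>)"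
    using \<rho> by (simp add: field_simps power2_eq_square flip: exp_add)
  also have "\<dots> \<le> \<rho> * exp (2 * u) - \<kappa> * exp u - Re s * u + (\<kappa> + Re s)\<^sup>2 / (4 * \<rho>)"
  proof -
    have "u \<le> exp u"
      using exp_ge_add_one_self[of u] by linarith
    then show ?thesis
      using mult_left_mono[of u "exp u" "Re s"] s by (simp add: algebra_simps)
  qed
  finally have le: "- \<rho> * exp (2 * u) + \<kappa> * exp u + Re s * u \<le> (\<kappa> + Re s)\<^sup>2 / (4 * \<rho>)"
    by simp
  have "cmod (gauss_cos w (of_real u + c) * exp (s * (of_real u + c))) \<le>
      exp (- \<rho> * exp (2 * u) + \<kappa> * exp u) * exp (Re s * u + Re (s * c))"
    unfolding norm_mult \<rho>_def \<kappa>_def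
    by (intro mult_mono cmod_gauss_cos_le) (auto simp: algebra_simps)
  also have "\<dots> = exp (- \<rho> * exp (2 * u) + \<kappa> * exp u + Re s * u) * exp (Re (s * c))"
    by (simp flip: exp_add)
  also have "\<dots> \<le> exp ((\<kappa> + Re s)\<^sup>2 / (4 * \<rho>)) * exp (Re (s * c))"
    using le by (intro mult_right_mono) auto
  finally show "cmod (gauss_cos w (of_real u + c) * exp (s * (of_real u + c))) \<le>
      exp ((cmod w * exp (Re c) + Re s)\<^sup>2 / (4 * (exp (2 * Re c) * cos (2 * Im c)))) *
      exp (Re (s * c))"
    by (simp only: \<rho>_def \<kappa>_def)
qed

text \<open>
  Turning the ray by \<open>\<theta>\<close> extracts the factor \<open>exp (\<i> * \<theta> * s)\<close>, which is exponentially small in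
  one vertical direction.
\<close>

lemma gauss_cos_mellin_bound:
  assumes s: "Re s > 0" and \<theta>: "\<bar>\<theta>\<bar> < pi / 4"
  shows "cmod (gauss_cos_mellin w s) \<le> exp (- (\<theta> * Im s)) *
    (LBINT u. cmod (gauss_cos w (of_real u + \<i> * of_real \<theta>)) * exp (Re s * u))"
proof -
  let ?c = "\<i> * complex_of_real \<theta>"
  let ?f = "\<lambda>u. gauss_cos w (of_real u + ?c) * exp (s * (of_real u + ?c))"
  have "cmod (gauss_cos_mellin w s) = cmod (LBINT u. ?f u)"
    using gauss_cos_mellin_integral[OF s, of ?c w] \<theta> by (simp add: has_bochner_integral_iff)
  also have "\<dots> \<le> (LBINT u. cmod (?f u))"
    by (rule integral_norm_bound)
  also have "\<dots> = (LBINT u. exp (- (\<theta> * Im s)) *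
      (cmod (gauss_cos w (of_real u + ?c)) * exp (Re s * u)))"
    by (intro Bochner_Integration.integral_cong)
       (auto simp: norm_mult algebra_simps simp flip: exp_add)
  finally show ?thesis
    by simp
qed

text \<open>
  The two angles \<open>\<theta>\<close> and \<open>- \<theta>\<close> take care of the two ends of the vertical line. For \<open>\<theta> = 0\<close> this
  says that the transform is bounded there.
\<close>

lemma gauss_cos_mellin_decay:
  assumes s: "Re s > 0" and \<theta>: "0 \<le> \<theta>" "\<theta> < pi / 4"
  obtains C where "\<And>y. cmod (gauss_cos_mellin w (s + \<i> * of_real y)) \<le> C * exp (- \<theta> * \<bar>y\<bar>)"
proof
  fix y :: real
  define J where "J = (\<lambda>\<theta>. LBINT u. cmod (gauss_cos w (of_real u + \<i> * of_real \<theta>)) * exp (Re s * u))"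
  define C where "C = exp (\<theta> * \<bar>Im s\<bar>) * (J \<theta> + J (- \<theta>))"
  have J0: "J \<theta> \<ge> 0" for \<theta>
    unfolding J_def by (intro integral_nonneg_AE) auto
  \<comment> \<open>The sign of the angle that makes the exponential decay on the half line of \<open>y\<close>.\<close>
  define \<eta> where "\<eta> = (if y \<ge> 0 then \<theta> else - \<theta>)"
  have "cmod (gauss_cos_mellin w (s + \<i> * of_real y)) \<le> exp (- (\<eta> * (Im s + y))) * J \<eta>"
    using gauss_cos_mellin_bound[of "s + \<i> * of_real y" \<eta> w] s \<theta> by (simp add: J_def \<eta>_def)
  also have "\<dots> \<le> exp (\<theta> * \<bar>Im s\<bar> - \<theta> * \<bar>y\<bar>) * (J \<theta> + J (- \<theta>))"
  proof (intro mult_mono)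
    have "- (\<eta> * Im s) \<le> \<theta> * \<bar>Im s\<bar>"
      using \<theta> abs_le_D1[of "- \<eta> * Im s" "\<theta> * \<bar>Im s\<bar>"] by (simp add: \<eta>_def abs_mult)
    moreover have "\<eta> * y = \<theta> * \<bar>y\<bar>"
      by (simp add: \<eta>_def)
    ultimately show "exp (- (\<eta> * (Im s + y))) \<le> exp (\<theta> * \<bar>Im s\<bar> - \<theta> * \<bar>y\<bar>)"
      by (simp add: algebra_simps)
  qed (use J0[of \<theta>] J0[of "- \<theta>"] in \<open>auto simp: \<eta>_def\<close>)
  also have "\<dots> = C * exp (- \<theta> * \<bar>y\<bar>)"
    by (simp add: C_def exp_diff exp_minus field_simps)
  finally show "cmod (gauss_cos_mellin w (s + \<i> * of_real y)) \<le>
      (exp (\<theta> * \<bar>Im s\<bar>) *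
       ((LBINT u. cmod (gauss_cos w (of_real u + \<i> * of_real \<theta>)) * exp (Re s * u)) +
        (LBINT u. cmod (gauss_cos w (of_real u + \<i> * of_real (- \<theta>))) * exp (Re s * u)))) *
      exp (- \<theta> * \<bar>y\<bar>)"
    by (simp only: C_def J_def)
qed

lemma integrable_exp_minus_abs:
  assumes "k > (0 :: real)"
  shows "integrable lborel (\<lambda>y. exp (- k * \<bar>y\<bar>))"
proof (rule Bochner_Integration.integrable_bound)
  have int: "integrable lborel (\<lambda>y. exp (- 1 * exp y + k * y))"
    using assms by (intro integrable_exp_minus_exp) auto
  then have "integrable lborel (\<lambda>y. exp (- 1 * exp (0 + (- 1) * y) + k * (0 + (- 1) * y)))"
    by (rule lborel_integrable_real_affine) simp
  with int show "integrable lborel (\<lambda>y. exp 1 * (exp (- 1 * exp y + k * y) +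
      exp (- 1 * exp (0 + (- 1) * y) + k * (0 + (- 1) * y))))"
    by (intro integrable_mult_right Bochner_Integration.integrable_add)
  \<comment> \<open>For \<open>t \<le> 0\<close> the factor \<open>exp (- exp t)\<close> is at least \<open>exp (- 1)\<close>.\<close>
  have *: "exp (k * t) \<le> exp 1 * exp (- 1 * exp t + k * t)" if "t \<le> 0" for t
    using that by (simp flip: exp_add)
  show "AE y in lborel. norm (exp (- k * \<bar>y\<bar>)) \<le> norm (exp 1 * (exp (- 1 * exp y + k * y) +
      exp (- 1 * exp (0 + (- 1) * y) + k * (0 + (- 1) * y))))"
  proof (rule AE_I2)
    fix y :: real
    have "exp (- k * \<bar>y\<bar>) \<le> exp 1 * exp (- 1 * exp (- \<bar>y\<bar>) + k * - \<bar>y\<bar>)"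
      using *[of "- \<bar>y\<bar>"] by simp
    also have "\<dots> \<le> exp 1 * (exp (- 1 * exp y + k * y) + exp (- 1 * exp (- y) + k * - y))"
      by (intro mult_left_mono) (auto simp: abs_if)
    finally show "norm (exp (- k * \<bar>y\<bar>)) \<le> norm (exp 1 * (exp (- 1 * exp y + k * y) +
      exp (- 1 * exp (0 + (- 1) * y) + k * (0 + (- 1) * y))))"
      by simp
  qed
qed simp

lemma gauss_cos_fourier:
  fixes s :: complex
  assumes s: "Re s > 0" and \<phi>: "\<bar>\<phi>\<bar> < pi / 4"
  shows "has_bochner_integral lborel
    (\<lambda>u. gauss_cos w (of_real u + \<i> * of_real \<phi>) * exp (s * (of_real u + \<i> * of_real \<phi>)) *
      iexp (y * u))
    (gauss_cos_mellin w (s + \<i> * of_real y) * exp (of_real (\<phi> * y)))"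
proof -
  let ?c = "\<i> * complex_of_real \<phi>"
  have "has_bochner_integral lborel
      (\<lambda>u. gauss_cos w (of_real u + ?c) * exp ((s + \<i> * of_real y) * (of_real u + ?c)) *
        exp (of_real (\<phi> * y)))
      (gauss_cos_mellin w (s + \<i> * of_real y) * exp (of_real (\<phi> * y)))"
    using s \<phi> by (intro has_bochner_integral_mult_left gauss_cos_mellin_integral) auto
  moreover have "exp ((s + \<i> * of_real y) * (of_real u + ?c)) * exp (of_real (\<phi> * y)) =
      exp (s * (of_real u + ?c)) * iexp (y * u)" for u
    by (simp add: algebra_simps flip: exp_add)
  ultimately show ?thesis
    by (simp only: mult.assoc)
qed

lemma gauss_cos_mellin_measurable:
  assumes s: "Re s > 0"
  shows "(\<lambda>y. gauss_cos_mellin w (s + \<i> * of_real y)) \<in> borel_measurable borel"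
proof -
  have "(\<lambda>y. LBINT u. gauss_cos w (of_real u) * exp (s * of_real u) * iexp (y * u))
      \<in> borel_measurable borel"
    by (intro fourier_measurable borel_measurable_continuous_onI continuous_intros)
  then show ?thesis
    using gauss_cos_fourier[OF s, of 0 w] by (simp add: has_bochner_integral_iff)
qed

lemma integrable_gauss_cos_mellin:
  assumes s: "Re s > 0" and c: "\<bar>Im c\<bar> < pi / 4"
  shows "integrable lborel (\<lambda>y. gauss_cos_mellin w (s + \<i> * of_real y) * exp (- (\<i> * of_real y * c)))"
proof -
  define \<theta> where "\<theta> = (\<bar>Im c\<bar> + pi / 4) / 2"
  have \<theta>: "0 \<le> \<theta>" "\<theta> < pi / 4" "\<bar>Im c\<bar> < \<theta>"
    using c by (auto simp: \<theta>_def)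
  obtain C where C: "\<And>y. cmod (gauss_cos_mellin w (s + \<i> * of_real y)) \<le> C * exp (- \<theta> * \<bar>y\<bar>)"
    using gauss_cos_mellin_decay[OF s \<theta>(1,2)] by blast
  have C0: "C \<ge> 0"
    using order_trans[OF norm_ge_zero C[of 0]] by simp
  show ?thesis
  proof (rule Bochner_Integration.integrable_bound)
    show "integrable lborel (\<lambda>y. C * exp (- (\<theta> - \<bar>Im c\<bar>) * \<bar>y\<bar>))"
      using \<theta> by (intro integrable_mult_right integrable_exp_minus_abs) auto
    have [measurable]: "(\<lambda>y. exp (- (\<i> * complex_of_real y * c))) \<in> borel_measurable borel"
      by (intro borel_measurable_continuous_onI continuous_intros)
    note [measurable] = gauss_cos_mellin_measurable[OF s]
    show "(\<lambda>y. gauss_cos_mellin w (s + \<i> * of_real y) * exp (- (\<i> * of_real y * c)))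
        \<in> borel_measurable lborel"
      by measurable
    show "AE y in lborel. norm (gauss_cos_mellin w (s + \<i> * of_real y) * exp (- (\<i> * of_real y * c)))
        \<le> norm (C * exp (- (\<theta> - \<bar>Im c\<bar>) * \<bar>y\<bar>))"
    proof (rule AE_I2)
      fix y
      have "y * Im c \<le> \<bar>y\<bar> * \<bar>Im c\<bar>"
        using abs_ge_self[of "y * Im c"] by (simp add: abs_mult)
      then have "norm (gauss_cos_mellin w (s + \<i> * of_real y) * exp (- (\<i> * of_real y * c)))
          \<le> (C * exp (- \<theta> * \<bar>y\<bar>)) * exp (\<bar>y\<bar> * \<bar>Im c\<bar>)"
        unfolding norm_mult using C0 by (intro mult_mono C) auto
      also have "\<dots> = C * exp (- (\<theta> - \<bar>Im c\<bar>) * \<bar>y\<bar>)"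
        by (simp add: algebra_simps flip: exp_add)
      finally show "norm (gauss_cos_mellin w (s + \<i> * of_real y) * exp (- (\<i> * of_real y * c)))
          \<le> norm (C * exp (- (\<theta> - \<bar>Im c\<bar>) * \<bar>y\<bar>))"
        using C0 by simp
    qed
  qed
qed

text \<open>
  Mellin inversion at the complex point \<open>exp c\<close>, that is, along the ray of angle \<open>Im c\<close>. The decay
  rate can be chosen between \<open>\<bar>Im c\<bar>\<close> and \<open>pi / 4\<close>, so it beats the growth of the kernel.
\<close>

theorem gauss_cos_mellin_inversion:
  assumes s: "Re s > 0" and c: "\<bar>Im c\<bar> < pi / 4"
  shows "(LBINT y. gauss_cos_mellin w (s + \<i> * of_real y) * exp (- (\<i> * of_real y * c))) =
    2 * pi * (gauss_cos w c * exp (s * c))"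
proof -
  define H where "H = (\<lambda>u. gauss_cos w (of_real u + \<i> * of_real (Im c)) *
      exp (s * (of_real u + \<i> * of_real (Im c))))"
  have hat: "has_bochner_integral lborel (\<lambda>u. H u * iexp (y * u))
      (gauss_cos_mellin w (s + \<i> * of_real y) * exp (of_real (Im c * y)))" for y
    unfolding H_def using s c by (rule gauss_cos_fourier)
  have hat_eq: "(LBINT u. H u * iexp (y * u)) =
      gauss_cos_mellin w (s + \<i> * of_real y) * exp (of_real (Im c * y))" for y
    using hat[of y] by (rule has_bochner_integral_integral_eq)
  obtain B where B: "\<And>u. cmod (H u) \<le> B"
    using gauss_cos_exp_bounded[OF s, of "\<i> * of_real (Im c)" w] c unfolding H_def by auto
  have kernel: "exp (- (\<i> * of_real y * (\<i> * of_real (Im c)))) = exp (complex_of_real (Im c * y))" for y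
    by (simp add: algebra_simps)
  have "(LBINT y. (LBINT u. H u * iexp (y * u)) * iexp (- (Re c * y))) = 2 * pi * H (Re c)"
  proof (rule fourier_inversion[OF _ _ B])
    show "integrable lborel H"
      using hat[of 0] by (simp add: has_bochner_integral_iff)
    show "continuous_on UNIV H"
      unfolding H_def by (intro continuous_intros)
    show "integrable lborel (\<lambda>y. LBINT u. H u * iexp (y * u))"
      using integrable_gauss_cos_mellin[OF s, of "\<i> * of_real (Im c)" w] c
      unfolding hat_eq kernel by simp
  qed
  moreover have "(LBINT u. H u * iexp (y * u)) * iexp (- (Re c * y)) =
      gauss_cos_mellin w (s + \<i> * of_real y) * exp (- (\<i> * of_real y * c))" for y
  proof -
    have "exp (complex_of_real (Im c * y)) * iexp (- (Re c * y)) = exp (- (\<i> * of_real y * c))"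
      unfolding exp_add[symmetric] by (rule arg_cong[of _ _ exp]) (simp add: complex_eq_iff)
    then show ?thesis
      unfolding hat_eq by (simp only: mult.assoc)
  qed
  moreover have "of_real (Re c) + \<i> * of_real (Im c) = c"
    by (simp add: complex_eq_iff)
  ultimately show ?thesis
    by (simp only: H_def)
qed

text \<open>
  A product of Mellin transforms is the transform of a multiplicative convolution. Only one of the
  two factors is inverted, on the ray of angle \<open>Im c\<close>; the other one keeps its integral along the
  positive axis. Thus complex points \<open>exp c\<close> need no analytic continuation from real ones.
\<close>

theorem mellin_convolution:
  assumes a: "Re a > 0" and b: "Re b > 0" and c: "\<bar>Im c\<bar> < pi / 4"
  shows "integrable lborel (\<lambda>y. gauss_cos_mellin w (a + \<i> * of_real y) *
      gauss_cos_mellin w (b + \<i> * of_real y) * exp (- (\<i> * of_real y * c)))" (is ?int)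
    and "integrable lborel (\<lambda>v. gauss_cos w (of_real v) * exp (b * of_real v) *
      (gauss_cos w (c - of_real v) * exp (a * (c - of_real v))))" (is ?int')
    and "(LBINT y. gauss_cos_mellin w (a + \<i> * of_real y) *
      gauss_cos_mellin w (b + \<i> * of_real y) * exp (- (\<i> * of_real y * c))) =
      2 * pi * (LBINT v. gauss_cos w (of_real v) * exp (b * of_real v) *
      (gauss_cos w (c - of_real v) * exp (a * (c - of_real v))))" (is ?eq)
proof -
  define A where "A = (\<lambda>y. gauss_cos_mellin w (a + \<i> * of_real y) * exp (- (\<i> * of_real y * c)))"
  define B where "B = (\<lambda>v. gauss_cos w (of_real v) * exp (b * of_real v))"
  have A: "integrable lborel A"
    unfolding A_def using a c by (rule integrable_gauss_cos_mellin)
  have hatB: "has_bochner_integral lborel (\<lambda>u. B u * iexp (y * u))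
      (gauss_cos_mellin w (b + \<i> * of_real y))" for y
    using gauss_cos_fourier[OF b, of 0 w y] by (simp add: B_def)
  have B: "integrable lborel B"
    using hatB[of 0] by (simp add: has_bochner_integral_iff)
  have hatB_eq: "(LBINT u. B u * iexp (y * u)) = gauss_cos_mellin w (b + \<i> * of_real y)" for y
    using hatB[of y] by (rule has_bochner_integral_integral_eq)
  have hatA_eq: "(LBINT y. A y * iexp (y * v)) =
      2 * pi * (gauss_cos w (c - of_real v) * exp (a * (c - of_real v)))" for v
  proof -
    have "A y * iexp (y * v) =
        gauss_cos_mellin w (a + \<i> * of_real y) * exp (- (\<i> * of_real y * (c - of_real v)))" for y
      by (simp add: A_def algebra_simps flip: exp_add)
    then show ?thesis
      using gauss_cos_mellin_inversion[OF a, of "c - of_real v" w] c by simp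
  qed
  obtain C where C: "\<And>y. cmod (gauss_cos_mellin w (b + \<i> * of_real y)) \<le> C"
    using gauss_cos_mellin_decay[OF b, of 0 w] by auto
  note [measurable] = gauss_cos_mellin_measurable[OF a] gauss_cos_mellin_measurable[OF b]
    borel_measurable_integrable[OF A] borel_measurable_integrable[OF B]
  have "integrable lborel (\<lambda>y. A y * gauss_cos_mellin w (b + \<i> * of_real y))"
  proof (rule Bochner_Integration.integrable_bound)
    show "integrable lborel (\<lambda>y. C * cmod (A y))"
      using A by (intro integrable_mult_right integrable_norm)
    show "(\<lambda>y. A y * gauss_cos_mellin w (b + \<i> * of_real y)) \<in> borel_measurable lborel"
      by measurable
    show "AE y in lborel. norm (A y * gauss_cos_mellin w (b + \<i> * of_real y)) \<le> norm (C * cmod (A y))"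
    proof (rule AE_I2)
      fix y
      have "0 \<le> C"
        using order_trans[OF norm_ge_zero C] .
      then show "norm (A y * gauss_cos_mellin w (b + \<i> * of_real y)) \<le> norm (C * cmod (A y))"
        using mult_left_mono[OF C[of y], of "cmod (A y)"] by (simp add: norm_mult mult.commute)
    qed
  qed
  then show ?int
    by (simp add: A_def mult_ac)
  obtain D where D: "\<And>u. cmod (gauss_cos w (of_real u + c) * exp (a * (of_real u + c))) \<le> D"
    using gauss_cos_exp_bounded[OF a c] by blast
  show ?int'
  proof (rule Bochner_Integration.integrable_bound)
    show "integrable lborel (\<lambda>v. D * cmod (B v))"
      using B by (intro integrable_mult_right integrable_norm)
    show "(\<lambda>v. gauss_cos w (of_real v) * exp (b * of_real v) *
      (gauss_cos w (c - of_real v) * exp (a * (c - of_real v)))) \<in> borel_measurable lborel"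
      by (auto intro!: borel_measurable_continuous_onI continuous_intros)
    show "AE v in lborel. norm (gauss_cos w (of_real v) * exp (b * of_real v) *
      (gauss_cos w (c - of_real v) * exp (a * (c - of_real v)))) \<le> norm (D * cmod (B v))"
    proof (rule AE_I2)
      fix v
      have "0 \<le> D"
        using order_trans[OF norm_ge_zero D] .
      have "cmod (gauss_cos w (c - of_real v) * exp (a * (c - of_real v))) \<le> D"
        using D[of "- v"] by (simp add: algebra_simps)
      then have "cmod (B v * (gauss_cos w (c - of_real v) * exp (a * (c - of_real v)))) \<le>
          cmod (B v) * D"
        unfolding norm_mult[of "B v"] by (rule mult_left_mono) simp
      with \<open>0 \<le> D\<close> show "norm (gauss_cos w (of_real v) * exp (b * of_real v) *
          (gauss_cos w (c - of_real v) * exp (a * (c - of_real v)))) \<le> norm (D * cmod (B v))"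
        by (simp only: B_def real_norm_def abs_mult abs_of_nonneg abs_norm_cancel mult.commute[of D])
    qed
  qed
  have "(LBINT y. A y * gauss_cos_mellin w (b + \<i> * of_real y)) =
      (LBINT v. 2 * pi * (B v * (gauss_cos w (c - of_real v) * exp (a * (c - of_real v)))))"
    using fourier_multiplication_formula[OF A B] unfolding hatA_eq hatB_eq
    by (simp only: mult.left_commute)
  then show ?eq
    unfolding integral_mult_right_zero by (simp only: A_def B_def mult_ac)
qed

section \<open>The integral representation of the generalized Bessel function\<close>

lemma gen_bessel_K_integrand_eq:
  assumes "x \<noteq> 0"
  shows "gen_bessel_K_integrand z w (2 * x) (Complex c y) =
    gauss_cos_mellin w (of_real c - z + \<i> * of_real y) *
    gauss_cos_mellin w (of_real c + z + \<i> * of_real y) *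
    exp (- (\<i> * of_real y * Ln x)) * exp (- (of_real c * Ln x))"
proof -
  define s where "s = of_real c + \<i> * complex_of_real y"
  have s: "Complex c y = s"
    by (simp add: s_def complex_eq_iff)
  have shift: "s - z = of_real c - z + \<i> * of_real y" "s + z = of_real c + z + \<i> * of_real y"
    by (simp_all add: s_def)
  have Ln2: "Ln 2 = complex_of_real (ln 2)"
    using Ln_of_real[of 2] by simp
  have Ln2x: "Ln (2 * x) = of_real (ln 2) + Ln x"
    using Ln_times_of_real[of 2 x] assms by (simp add: Ln2)
  have quarter: "exp (- (2 * complex_of_real (ln 2))) = 1 / 4"
    by (simp add: exp_minus exp_double exp_of_real)
  have "2 powr (s - 2) * (2 * x) powr (- s) =
      exp (- (2 * complex_of_real (ln 2))) * exp (- (s * Ln x))"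
  proof -
    have "2 powr (s - 2) = exp ((s - 2) * of_real (ln 2))"
      by (simp add: powr_def Ln2)
    moreover have "(2 * x) powr (- s) = exp (- s * (of_real (ln 2) + Ln x))"
      using assms by (simp only: powr_def Ln2x) simp
    ultimately show ?thesis
      by (simp add: algebra_simps flip: exp_add)
  qed
  also have "exp (- (s * Ln x)) = exp (- (\<i> * of_real y * Ln x)) * exp (- (of_real c * Ln x))"
    by (simp add: s_def algebra_simps flip: exp_add)
  finally have powers: "2 powr (s - 2) * (2 * x) powr (- s) =
      1 / 4 * (exp (- (\<i> * of_real y * Ln x)) * exp (- (of_real c * Ln x)))"
    unfolding quarter .
  have "gen_bessel_K_integrand z w (2 * x) (Complex c y) =
      4 * gauss_cos_mellin w (s - z) * gauss_cos_mellin w (s + z) *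
      (2 powr (s - 2) * (2 * x) powr (- s))"
    unfolding gen_bessel_K_integrand_def gauss_cos_mellin_def s by simp
  then show ?thesis
    unfolding powers shift by simp
qed

theorem theorem1p7:
  fixes z w x :: complex and c :: real
  assumes "x \<noteq> 0" and "\<bar>Arg x\<bar> < pi / 4"
    and "c > \<bar>Re z\<bar>"
  shows "integrable lborel (\<lambda>y. gen_bessel_K_integrand z w (2 * x) (Complex c y))
    \<and> set_integrable lborel {0<..}
         (\<lambda>t. exp (- (of_real t)\<^sup>2 - x\<^sup>2 / (of_real t)\<^sup>2) * cos (w * of_real t)
               * cos (w * x / of_real t) * of_real t powr (2 * z - 1))
    \<and> gen_bessel_K c z w (2 * x) =
        x powr (- z) *
        (LBINT t:{0<..}. exp (- (of_real t)\<^sup>2 - x\<^sup>2 / (of_real t)\<^sup>2) * cos (w * of_real t)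
               * cos (w * x / of_real t) * of_real t powr (2 * z - 1))"
proof -
  let ?f = "\<lambda>t. exp (- (of_real t)\<^sup>2 - x\<^sup>2 / (of_real t)\<^sup>2) * cos (w * of_real t)
               * cos (w * x / of_real t) * of_real t powr (2 * z - 1)"
  define a b where "a = of_real c - z" and "b = of_real c + z"
  have a: "Re a > 0" and b: "Re b > 0"
    using assms(3) by (auto simp: a_def b_def)
  have L: "\<bar>Im (Ln x)\<bar> < pi / 4"
    using assms(1,2) by (simp add: Arg_eq_Im_Ln)
  note conv = mellin_convolution[OF a b L, of w]
  define E where "E = (\<lambda>v. gauss_cos w (of_real v) * gauss_cos w (Ln x - of_real v) *
      exp (2 * z * of_real v))"
  define P where "P = (\<lambda>y. gauss_cos_mellin w (a + \<i> * of_real y) *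
      gauss_cos_mellin w (b + \<i> * of_real y) * exp (- (\<i> * of_real y * Ln x)))"
  have integrand: "gen_bessel_K_integrand z w (2 * x) (Complex c y) =
      P y * exp (- (of_real c * Ln x))" for y
    unfolding gen_bessel_K_integrand_eq[OF assms(1)] P_def a_def b_def ..
  \<comment> \<open>The exponents in \<open>c\<close> combine to a constant factor; only \<open>2 * z\<close> is left under the integral.\<close>
  have convolution: "gauss_cos w (of_real v) * exp (b * of_real v) *
      (gauss_cos w (Ln x - of_real v) * exp (a * (Ln x - of_real v))) = exp (a * Ln x) * E v" for v
  proof -
    have "exp (b * of_real v) * exp (a * (Ln x - of_real v)) =
        exp (a * Ln x) * exp (2 * z * of_real v)"
      by (simp add: a_def b_def algebra_simps flip: exp_add)
    then show ?thesis
      by (simp add: E_def mult_ac)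
  qed
  have E: "integrable lborel E"
  proof -
    have "integrable lborel (\<lambda>v. exp (- (a * Ln x)) * (exp (a * Ln x) * E v))"
      using conv(2) unfolding convolution by (rule integrable_mult_right)
    then show ?thesis
      by (simp flip: mult.assoc exp_add)
  qed
  have subst: "exp v *\<^sub>R ?f (exp v) = E v" for v
  proof -
    have "exp (Ln x) = x"
      using assms(1) by simp
    then have x: "exp (Ln x - of_real v) = x / of_real (exp v)"
      by (simp add: exp_diff exp_of_real)
    have sq: "exp (2 * \<zeta>) = (exp \<zeta>)\<^sup>2" for \<zeta> :: complex
      by (rule exp_double)
    have "of_real (exp v) * complex_of_real (exp v) powr (2 * z - 1) = exp (2 * z * of_real v)"
      by (simp add: powr_def Ln_of_real algebra_simps flip: exp_of_real exp_add)
    moreover have "exp (- (complex_of_real (exp v))\<^sup>2 - x\<^sup>2 / (of_real (exp v))\<^sup>2) =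
        exp (- (of_real (exp v))\<^sup>2) * exp (- (x / of_real (exp v))\<^sup>2)"
      by (simp add: power_divide flip: exp_add)
    ultimately show ?thesis
      unfolding E_def gauss_cos_def sq x exp_of_real scaleR_conv_of_real
      by (simp add: mult_ac)
  qed
  have "continuous_on {0<..} ?f"
    by (intro continuous_intros) (auto simp: complex_nonpos_Reals_iff)
  from exp_substitution[OF this, of "integral\<^sup>L lborel E"] E
  have f: "set_integrable lborel {0<..} ?f" "(LBINT t:{0<..}. ?f t) = integral\<^sup>L lborel E"
    unfolding subst by (simp_all add: has_bochner_integral_iff)
  have P: "integrable lborel P" "integral\<^sup>L lborel P = 2 * pi * (exp (a * Ln x) * integral\<^sup>L lborel E)"
    using conv(1,3) unfolding convolution P_def by simp_all
  have "gen_bessel_K c z w (2 * x) = exp (- (of_real c * Ln x)) * exp (a * Ln x) * integral\<^sup>L lborel E"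
    unfolding gen_bessel_K_def integrand by (simp add: P(2))
  also have "exp (- (of_real c * Ln x)) * exp (a * Ln x) = x powr (- z)"
    using assms(1) by (simp add: powr_def a_def algebra_simps flip: exp_add)
  finally show ?thesis
    using f P(1) unfolding integrand by simp
qed

end
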